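(* Let $k\in\mathbb{N}_+$ and $\underline{\lambda}=(\lambda_1,\dots,\lambda_k)\in\mathbb{R}_+^k$. If $\underline{\lambda}$ is fully supercritical, then for every nonempty $I\subsetneq[k]$, $$p_I=1+\frac{W\left(-\Big(\sum_{i\in[k]\setminus I}\lambda_i\Big)\exp\Big(-\sum_{i\in I}\lambda_i\,p_{I\setminus\{i\}}-\sum_{i\in[k]\setminus I}\lambda_i\Big)\right)}{\sum_{i\in[k]\setminus I}\lambda_i},$$ and $$p_{[k]}=1-\exp\Big(-\sum_{i\in[k]}\lambda_i\,p_{[k]\setminus\{i\}}\Big).$$
   Context: Notation: $\mathbb{N}_+=\{1,2,\dots\}$, $\mathbb{R}_+=(0,\infty)$, $[k]=\{1,\dots,k\}$. The vector $\underline{\lambda}$ is fully supercritical if $\sum_{j\in[k]\setminus\{i\}}\lambda_j>1$ for all $i\in[k]$. $W$ is the principal real branch of the Lambert $W$ function: for $x\ge-1/\mathrm{e}$, $W(x)$ is the unique real $w\ge-1$ with $w\mathrm{e}^w=x$. $G_\infty=G_\infty(r)\sim\mathcal{G}_\infty(\underline{\lambda})$ denotes the random (possibly infinite) edge-colored tree with root $r$ generated recursively: given the tree up to generation $d$, each vertex $v$ in generation $d$ has $X_{v,i}\sim\mathrm{POI}(\lambda_i)$ children joined to it by an edge of color $i$ ($i\in[k]$), all these variables being conditionally independent. Write $r\stackrel{G_\infty^{\setminus i}}{\longleftrightarrow}\infty$ for the event that there is an infinite path starting at $r$ (going through descendants) which contains no edge of color $i$. Define $p_\emptyset=0$ and $p_I=\mathbb{P}\Big(\bigcup_{i\in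 I}\big\{r\stackrel{G_\infty^{\setminus i}}{\longleftrightarrow}\infty\big\}\Big)$ for nonempty $I\subseteq[k]$. *)

theory Defs
  imports "HOL-Probability.Probability"
begin

text \<open>
  Ulam--Harris encoding: a vertex is the list of steps from the root, where a step \<open>(i, m)\<close> goes
  to the \<open>m\<close>-th child (counted from \<open>0\<close>) along an edge of colour \<open>i\<close>. The colours are \<open>{1..k}\<close>.
  An offspring array \<open>X\<close> gives the number \<open>X (v, i)\<close> of children of colour \<open>i\<close> for every potential
  vertex \<open>v\<close>; the values at vertices that do not occur in the tree have no effect.
\<close>

type_synonym vertex = "(nat \<times> nat) list"

type_synonym offspring = "vertex \<times> nat \<Rightarrow> nat"

definition potential_vertices :: "nat \<Rightarrow> vertex set" where
  "potential_vertices k = lists ({1..k} \<times> UNIV)"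

inductive_set tree :: "nat \<Rightarrow> offspring \<Rightarrow> vertex set"
  for k :: nat and X :: offspring where
  root: "[] \<in> tree k X"
| child: "v \<in> tree k X \<Longrightarrow> i \<in> {1..k} \<Longrightarrow> m < X (v, i) \<Longrightarrow> v @ [(i, m)] \<in> tree k X"

definition child_edge :: "nat \<Rightarrow> offspring \<Rightarrow> nat \<Rightarrow> vertex \<Rightarrow> vertex \<Rightarrow> bool" where
  "child_edge k X j u v \<longleftrightarrow> u \<in> tree k X \<and> v \<in> tree k X \<and> (\<exists>m. v = u @ [(j, m)])"

definition root_to_infinity_avoiding :: "nat \<Rightarrow> offspring \<Rightarrow> nat \<Rightarrow> bool" where
  "root_to_infinity_avoiding k X i \<longleftrightarrow>
     (\<exists>\<pi> :: nat \<Rightarrow> vertex. \<pi> 0 = [] \<and>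
        (\<forall>n. \<exists>j\<in>{1..k} - {i}. child_edge k X j (\<pi> n) (\<pi> (Suc n))))"

definition tree_law :: "nat \<Rightarrow> (nat \<Rightarrow> real) \<Rightarrow> offspring measure" where
  "tree_law k lam =
     (\<Pi>\<^sub>M (v, i) \<in> potential_vertices k \<times> {1..k}. measure_pmf (poisson_pmf (lam i)))"

text \<open>
  The event is measurable: all offspring numbers are finite, so by Koenig's lemma an infinite path
  exists iff there are paths of every finite length. For \<open>I = {}\<close> the event is empty, so
  \<open>p_inf k lam {} = 0\<close>.
\<close>

definition p_inf :: "nat \<Rightarrow> (nat \<Rightarrow> real) \<Rightarrow> nat set \<Rightarrow> real" where
  "p_inf k lam I =
     measure (tree_law k lam)
       (\<Union>i\<in>I. {X \<in> space (tree_law k lam). root_to_infinity_avoiding k X i})"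

definition fully_supercritical :: "nat \<Rightarrow> (nat \<Rightarrow> real) \<Rightarrow> bool" where
  "fully_supercritical k lam \<longleftrightarrow> (\<forall>i\<in>{1..k}. (\<Sum>j\<in>{1..k} - {i}. lam j) > 1)"

text \<open>Principal real branch of the Lambert function; meaningful for \<open>x \<ge> - exp (-1)\<close>.\<close>

definition lambert_W :: "real \<Rightarrow> real" where
  "lambert_W x = (THE w. w \<ge> -1 \<and> w * exp w = x)"

end

theory Submission
  imports Defs
begin

text \<open>
  Fix a set \<open>I\<close> of colours and ask for an infinite path from the root that avoids some colour of
  \<open>I\<close>. If its first edge has colour \<open>j\<close>, then \<open>j\<close> can no longer be the avoided colour, so the
  rest of the path is an infinite path from a child of colour \<open>j\<close> that avoids some colour of
  \<open>I - {j}\<close>; conversely every such path at a child extends to the root. The subtrees at the children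
  are independent copies of the whole tree, and the number of children of colour \<open>j\<close> is Poisson,
  so by the Poisson generating function the probability that no child has such a path is a product
  of exponentials:
  \<open>p\<^sub>I = 1 - exp (- (\<Sum>j. lam j * p\<^bsub>I - {j}\<^esub>))\<close>. This is \<open>p_inf_recursion\<close>, and for
  \<open>I = {1..k}\<close> it is already the claimed formula.

  For a proper subset \<open>I\<close> the colours \<open>j\<close> outside \<open>I\<close> contribute \<open>p\<^sub>I\<close> itself. With
  \<open>s = (\<Sum>j\<notin>I. lam j)\<close> and \<open>c = (\<Sum>j\<in>I. lam j * p\<^bsub>I - {j}\<^esub>)\<close> the number \<open>p = p\<^sub>I\<close> therefore solves
  \<open>p = 1 - exp (- c - s * p)\<close>, that is, \<open>w = s * (p - 1)\<close> solves
  \<open>w * exp w = - s * exp (- c - s)\<close>. It remains to see that \<open>w\<close> lies on the principal branch,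
  \<open>w \<ge> - 1\<close>. The right-hand side of the equation for \<open>p\<close> is concave in \<open>p\<close> and nonnegative at \<open>0\<close>,
  so its slope \<open>s * (1 - p) = - w\<close> at a positive fixed point is at most \<open>1\<close>
  (\<open>fixpoint_eq_lambert_W\<close>). Hence all that is needed is \<open>p\<^sub>I > 0\<close>. By monotonicity in \<open>I\<close> this
  reduces to \<open>p\<^bsub>{i}\<^esub> > 0\<close>, the survival of the supercritical branching process that is left after
  the edges of colour \<open>i\<close> are removed (\<open>p_inf_singleton_pos\<close>).

  Measurability and the approximation of survival by finite depths both come from Koenig's lemma,
  \<open>root_to_infinity_avoiding_iff_reaches\<close>.
\<close>

section \<open>Infinite paths and Koenig's lemma\<close>

definition subtree :: "nat \<times> nat \<Rightarrow> offspring \<Rightarrow> offspring" where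
  "subtree e X = (\<lambda>(v, c). X (e # v, c))"

text \<open>A path of length \<open>n\<close> avoiding colour \<open>i\<close>, unfolded at the root as the branching argument needs it.\<close>
fun reaches :: "nat \<Rightarrow> nat \<Rightarrow> nat \<Rightarrow> offspring \<Rightarrow> bool" where
  "reaches k i 0 X \<longleftrightarrow> True"
| "reaches k i (Suc n) X \<longleftrightarrow>
     (\<exists>j\<in>{1..k} - {i}. \<exists>m<X ([], j). reaches k i n (subtree (j, m) X))"

text \<open>
  An infinite path recorded by its steps: the vertex at depth \<open>n\<close> is \<open>map f [0..<n]\<close>. Unlike a
  sequence of vertices, a sequence of steps can be shifted into a subtree without relabelling.
\<close>
definition ray :: "nat \<Rightarrow> offspring \<Rightarrow> nat \<Rightarrow> (nat \<Rightarrow> nat \<times> nat) \<Rightarrow> bool" where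
  "ray k X i f \<longleftrightarrow> (\<forall>n. fst (f n) \<in> {1..k} - {i} \<and> snd (f n) < X (map f [0..<n], fst (f n)))"

lemma root_to_infinity_avoiding_iff_ray:
  "root_to_infinity_avoiding k X i \<longleftrightarrow> (\<exists>f. ray k X i f)"
proof
  assume "root_to_infinity_avoiding k X i"
  then obtain p where p0: "p 0 = []"
    and p: "\<And>n. \<exists>j\<in>{1..k} - {i}. child_edge k X j (p n) (p (Suc n))"
    unfolding root_to_infinity_avoiding_def by auto
  define f where "f n = last (p (Suc n))" for n
  have step: "fst (f n) \<in> {1..k} - {i}" "p (Suc n) = p n @ [f n]" "p (Suc n) \<in> tree k X" for n
    using p[of n] unfolding child_edge_def f_def by auto
  have pf: "p n = map f [0..<n]" for n
    by (induction n) (simp_all add: p0 step)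
  have "snd (f n) < X (map f [0..<n], fst (f n))" for n
    using step(3)[of n] by (cases rule: tree.cases) (auto simp: step(2) simp flip: pf)
  then show "\<exists>f. ray k X i f"
    using step(1) unfolding ray_def by blast
next
  assume "\<exists>f. ray k X i f"
  then obtain f where f: "\<And>n. fst (f n) \<in> {1..k} - {i}"
    "\<And>n. snd (f n) < X (map f [0..<n], fst (f n))"
    unfolding ray_def by blast
  have tree: "map f [0..<n] \<in> tree k X" for n
  proof (induction n)
    case 0
    show ?case by (simp add: tree.root)
  next
    case (Suc n)
    have "map f [0..<n] @ [(fst (f n), snd (f n))] \<in> tree k X"
      using Suc.IH f[of n] by (intro tree.child) auto
    then show ?case by simp
  qed
  have "child_edge k X (fst (f n)) (map f [0..<n]) (map f [0..<Suc n])" for n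
    unfolding child_edge_def using tree[of n] tree[of "Suc n"] by (auto intro!: exI[of _ "snd (f n)"])
  then show "root_to_infinity_avoiding k X i"
    unfolding root_to_infinity_avoiding_def using f(1)
    by (intro exI[of _ "\<lambda>n. map f [0..<n]"] conjI allI bexI[of _ "fst (f n)" for n]) simp_all
qed

lemma ray_Suc:
  "ray k X i f \<longleftrightarrow>
     fst (f 0) \<in> {1..k} - {i} \<and> snd (f 0) < X ([], fst (f 0)) \<and>
     ray k (subtree (f 0) X) i (\<lambda>n. f (Suc n))"
proof -
  have *: "map f [0..<Suc n] = f 0 # map (\<lambda>n. f (Suc n)) [0..<n]" for n
    by (simp add: upt_conv_Cons map_Suc_upt[symmetric] del: upt_Suc)
  have split: "(\<forall>n. P n) \<longleftrightarrow> P 0 \<and> (\<forall>n. P (Suc n))" for P :: "nat \<Rightarrow> bool"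
    by (metis not0_implies_Suc)
  show ?thesis
    unfolding ray_def subtree_def
    by (subst split) (simp only: * prod.case upt_0 list.map conj_assoc)
qed

lemma reaches_SucD: "reaches k i (Suc n) X \<Longrightarrow> reaches k i n X"
proof (induction n arbitrary: X)
  case (Suc n)
  then show ?case
    unfolding reaches.simps(2)[of k i "Suc n" X] reaches.simps(2)[of k i n X] by blast
qed simp

lemma reaches_antimono: "n \<le> n' \<Longrightarrow> reaches k i n' X \<Longrightarrow> reaches k i n X"
  by (induction rule: dec_induct) (blast dest: reaches_SucD)+

text \<open>
  The compactness step of Koenig's lemma. The root has finitely many children, so if each
  of them failed at some depth, all of them would fail at the largest of these depths.
\<close>
lemma reaches_every_depth_step:
  "(\<forall>n. reaches k i n X) \<longleftrightarrow>
     (\<exists>j\<in>{1..k} - {i}. \<exists>m<X ([], j). \<forall>n. reaches k i n (subtree (j, m) X))"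
proof
  assume all: "\<forall>n. reaches k i n X"
  define T where "T = (SIGMA j:{1..k} - {i}. {..<X ([], j)})"
  have "\<exists>e\<in>T. \<forall>n. reaches k i n (subtree e X)"
  proof (rule ccontr)
    assume "\<not> ?thesis"
    then obtain N where N: "\<And>e. e \<in> T \<Longrightarrow> \<not> reaches k i (N e) (subtree e X)"
      by metis
    have "finite T"
      unfolding T_def by auto
    then have "N e \<le> Max (N ` T)" if "e \<in> T" for e
      using that by simp
    then have "\<not> reaches k i (Max (N ` T)) (subtree e X)" if "e \<in> T" for e
      using N[OF that] reaches_antimono that by blast
    moreover have "\<exists>e\<in>T. reaches k i (Max (N ` T)) (subtree e X)"
      using all[rule_format, of "Suc (Max (N ` T))"] unfolding T_def by fastforce
    ultimately show False
      by blast
  qed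
  then show "\<exists>j\<in>{1..k} - {i}. \<exists>m<X ([], j). \<forall>n. reaches k i n (subtree (j, m) X)"
    unfolding T_def by auto
next
  assume r: "\<exists>j\<in>{1..k} - {i}. \<exists>m<X ([], j). \<forall>n. reaches k i n (subtree (j, m) X)"
  show "\<forall>n. reaches k i n X"
  proof
    fix n show "reaches k i n X"
      using r by (cases n) auto
  qed
qed

text \<open>
  The path is built by always moving to a child that still has paths of every length
  (\<open>good\<close>); \<open>Y n\<close> is the subtree seen after \<open>n\<close> moves.
\<close>
lemma root_to_infinity_avoiding_iff_reaches:
  "root_to_infinity_avoiding k X i \<longleftrightarrow> (\<forall>n. reaches k i n X)"
  unfolding root_to_infinity_avoiding_iff_ray
proof
  have "reaches k i n X" if "ray k X i f" for n f
    using that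
  proof (induction n arbitrary: X f)
    case (Suc n)
    obtain j m where e: "f 0 = (j, m)"
      by (cases "f 0")
    from Suc.prems have "j \<in> {1..k} - {i}" "m < X ([], j)"
      and ray: "ray k (subtree (j, m) X) i (\<lambda>n. f (Suc n))"
      unfolding ray_Suc[of k X i f] e by simp_all
    moreover from ray have "reaches k i n (subtree (j, m) X)"
      by (rule Suc.IH)
    ultimately show ?case
      unfolding reaches.simps by blast
  qed simp
  then show "\<exists>f. ray k X i f \<Longrightarrow> \<forall>n. reaches k i n X"
    by blast
next
  assume X: "\<forall>n. reaches k i n X"
  define good where
    "good Z e \<longleftrightarrow> fst e \<in> {1..k} - {i} \<and> snd e < Z ([], fst e) \<and>
       (\<forall>n. reaches k i n (subtree e Z))" for Z e
  define g where "g Z = (SOME e. good Z e)" for Z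
  have g: "good Z (g Z)" if Z: "\<forall>n. reaches k i n Z" for Z
  proof -
    obtain j m where "j \<in> {1..k} - {i}" "m < Z ([], j)" "\<forall>n. reaches k i n (subtree (j, m) Z)"
      using Z reaches_every_depth_step[of k i Z] by blast
    then have "good Z (j, m)"
      by (simp add: good_def)
    then have "\<exists>e. good Z e" ..
    then show ?thesis
      unfolding g_def by (rule someI_ex)
  qed
  define Y where "Y = rec_nat X (\<lambda>_ Z. subtree (g Z) Z)"
  have Y0: "Y 0 = X" and YS: "Y (Suc n) = subtree (g (Y n)) (Y n)" for n
    by (simp_all add: Y_def)
  have Yr: "\<forall>l. reaches k i l (Y n)" for n
  proof (induction n)
    case (Suc n)
    then show ?case using g[of "Y n"] by (simp add: YS good_def)
  qed (simp add: Y0 X)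
  have Ypath: "Y n (v, c) = X (map (\<lambda>n. g (Y n)) [0..<n] @ v, c)" for n v c
    by (induction n arbitrary: v) (simp_all add: Y0 YS subtree_def)
  have "ray k X i (\<lambda>n. g (Y n))"
    unfolding ray_def using g[OF Yr] Ypath[where v = "[]"] by (simp add: good_def)
  then show "\<exists>f. ray k X i f"
    by blast
qed

lemma root_to_infinity_avoiding_step:
  "root_to_infinity_avoiding k X i \<longleftrightarrow>
     (\<exists>j\<in>{1..k} - {i}. \<exists>m<X ([], j). root_to_infinity_avoiding k (subtree (j, m) X) i)"
  unfolding root_to_infinity_avoiding_iff_reaches by (rule reaches_every_depth_step)

lemma poisson_generating_function:
  assumes "l > 0"
  shows "(\<lambda>n. pmf (poisson_pmf l) n * x ^ n) sums exp (l * (x - 1))"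
proof -
  have "(\<lambda>n. exp (- l) * ((l * x) ^ n /\<^sub>R fact n)) sums (exp (- l) * exp (l * x))"
    by (intro sums_mult exp_converges)
  then show ?thesis
    using assms by (simp add: power_mult_distrib divide_simps exp_diff exp_minus algebra_simps)
qed

section \<open>The law of the tree and of its subtrees\<close>

locale poisson_tree =
  fixes k :: nat and lam :: "nat \<Rightarrow> real"
  assumes lam_pos: "\<And>i. i \<in> {1..k} \<Longrightarrow> lam i > 0"
begin

abbreviation M :: "offspring measure" where "M \<equiv> tree_law k lam"

definition sites :: "(vertex \<times> nat) set" where
  "sites = potential_vertices k \<times> {1..k}"

text \<open>
  Written as a function of the site that ignores the vertex, so that the product measure is visibly
  invariant when the sites below a vertex are relabelled as sites of the whole tree.
\<close>
definition offspring_law :: "vertex \<times> nat \<Rightarrow> nat measure" where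
  "offspring_law x = measure_pmf (poisson_pmf (lam (snd x)))"

definition below :: "nat \<times> nat \<Rightarrow> (vertex \<times> nat) set" where
  "below e = (\<lambda>x. (e # fst x, snd x)) ` sites"

lemma tree_law_eq: "M = PiM sites offspring_law"
  unfolding tree_law_def sites_def offspring_law_def by (intro PiM_cong) auto

lemma prob_space_offspring_law: "prob_space (offspring_law x)"
  unfolding offspring_law_def by (rule prob_space_measure_pmf)

lemma sets_offspring_law [measurable_cong]: "sets (offspring_law x) = sets (count_space UNIV)"
  unfolding offspring_law_def by simp

sublocale prob_space M
  unfolding tree_law_eq by (intro prob_space_PiM prob_space_offspring_law)

lemma measurable_root_offspring:
  "([], j) \<in> K \<Longrightarrow> (\<lambda>X. X ([], j)) \<in> measurable (PiM K offspring_law) (count_space UNIV)"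
  using measurable_component_singleton[of "([], j)" K offspring_law]
  unfolding measurable_cong_sets[OF refl sets_offspring_law] .

lemma Nil_in_sites: "([], j) \<in> sites \<longleftrightarrow> j \<in> {1..k}"
  by (simp add: sites_def potential_vertices_def)

lemma Cons_in_sites: "j \<in> {1..k} \<Longrightarrow> ((j, m) # v, c) \<in> sites \<longleftrightarrow> (v, c) \<in> sites"
  by (auto simp: sites_def potential_vertices_def)

lemma below_subset_sites: "j \<in> {1..k} \<Longrightarrow> below (j, m) \<subseteq> sites"
  by (auto simp: below_def Cons_in_sites)

text \<open>
  Points of the product space are \<open>undefined\<close> off the sites. Passing to a subtree at a
  child of a colour in \<open>{1..k}\<close> respects this convention, hence is a reindexing of coordinates
  exactly, not just on the sites.
\<close>
lemma subtree_eq_reindex: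
  assumes "j \<in> {1..k}" "X \<in> extensional sites"
  shows "subtree (j, m) X = (\<lambda>x\<in>sites. X ((j, m) # fst x, snd x))"
proof
  fix x
  have "X ((j, m) # fst x, snd x) = undefined" if "x \<notin> sites"
    using that assms(2) Cons_in_sites[OF assms(1), of m "fst x" "snd x"]
    by (auto simp: extensional_def)
  then show "subtree (j, m) X x = (\<lambda>x\<in>sites. X ((j, m) # fst x, snd x)) x"
    by (cases x) (auto simp: subtree_def)
qed

lemma subtree_measurable:
  assumes j: "j \<in> {1..k}" and K: "below (j, m) \<subseteq> K" "K \<subseteq> sites"
  shows "subtree (j, m) \<in> measurable (PiM K offspring_law) M"
proof -
  have "subtree (j, m) X = (\<lambda>x\<in>sites. X ((j, m) # fst x, snd x))"
    if "X \<in> space (PiM K offspring_law)" for X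
    using that K(2) by (intro subtree_eq_reindex[OF j]) (auto simp: space_PiM PiE_def extensional_def)
  moreover have "(\<lambda>X. \<lambda>x\<in>sites. X ((j, m) # fst x, snd x))
      \<in> measurable (PiM K offspring_law) (PiM sites offspring_law)"
  proof (rule measurable_restrict)
    fix x assume "x \<in> sites"
    then have "(\<lambda>X. X ((j, m) # fst x, snd x))
        \<in> measurable (PiM K offspring_law) (offspring_law ((j, m) # fst x, snd x))"
      using K(1) by (intro measurable_component_singleton) (auto simp: below_def)
    then show "(\<lambda>X. X ((j, m) # fst x, snd x))
        \<in> measurable (PiM K offspring_law) (offspring_law x)"
      by (simp add: offspring_law_def)
  qed
  ultimately show ?thesis
    unfolding tree_law_eq by (subst measurable_cong) auto
qed

lemma subtree_measurable_M: "j \<in> {1..k} \<Longrightarrow> subtree (j, m) \<in> measurable M M"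
  using subtree_measurable[of j m sites] below_subset_sites unfolding tree_law_eq by auto

text \<open>
  Self-similarity: selecting coordinates of a product measure along an injection that preserves the
  factors gives the same product measure.
\<close>
lemma distr_subtree:
  assumes j: "j \<in> {1..k}"
  shows "distr M M (subtree (j, m)) = M"
proof -
  let ?f = "\<lambda>x. ((j, m) # fst x, snd x)"
  have eq: "subtree (j, m) X = (\<lambda>x\<in>sites. X (?f x))" if "X \<in> space M" for X
    using that by (intro subtree_eq_reindex[OF j]) (simp add: tree_law_eq space_PiM PiE_def)
  have law: "offspring_law (?f x) = offspring_law x" for x
    by (simp add: offspring_law_def)
  have "distr (PiM sites offspring_law) (PiM sites (\<lambda>x. offspring_law (?f x)))
      (\<lambda>X. \<lambda>x\<in>sites. X (?f x)) = PiM sites (\<lambda>x. offspring_law (?f x))"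
    using Cons_in_sites[OF j, of m]
    by (intro distr_PiM_reindex prob_space_offspring_law) (auto simp: inj_on_def prod_eq_iff)
  then have "distr M M (\<lambda>X. \<lambda>x\<in>sites. X (?f x)) = M"
    unfolding law tree_law_eq .
  then show ?thesis
    using distr_cong[OF refl refl eq, of M] by simp
qed

lemma prob_subtree:
  assumes "j \<in> {1..k}" and [measurable]: "Measurable.pred M Q"
  shows "prob {X \<in> space M. Q (subtree (j, m) X)} = prob {X \<in> space M. Q X}"
proof -
  note [measurable] = subtree_measurable_M[OF assms(1), of m]
  have "prob {X \<in> space M. Q X} = measure (distr M M (subtree (j, m))) {X \<in> space M. Q X}"
    unfolding distr_subtree[OF assms(1)] ..
  also have "\<dots> = prob (subtree (j, m) -` {X \<in> space M. Q X} \<inter> space M)"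
    by (intro measure_distr) measurable
  also have "subtree (j, m) -` {X \<in> space M. Q X} \<inter> space M
      = {X \<in> space M. Q (subtree (j, m) X)}"
    using measurable_space[OF subtree_measurable_M[OF assms(1), of m]] by auto
  finally show ?thesis ..
qed

lemma prob_root_offspring:
  assumes "j \<in> {1..k}"
  shows "prob {X \<in> space M. X ([], j) = n} = pmf (poisson_pmf (lam j)) n"
proof -
  have site: "([], j) \<in> sites"
    using assms by (simp add: Nil_in_sites)
  have "distr M (offspring_law ([], j)) (\<lambda>X. X ([], j)) = offspring_law ([], j)"
    unfolding tree_law_eq by (intro distr_PiM_component prob_space_offspring_law site)
  then have "measure (offspring_law ([], j)) {n}
      = measure (distr M (offspring_law ([], j)) (\<lambda>X. X ([], j))) {n}"
    by simp
  also have "\<dots> = prob ((\<lambda>X. X ([], j)) -` {n} \<inter> space M)"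
    unfolding tree_law_eq using site
    by (intro measure_distr measurable_component_singleton) (auto simp: sets_offspring_law)
  also have "(\<lambda>X. X ([], j)) -` {n} \<inter> space M = {X \<in> space M. X ([], j) = n}"
    by auto
  finally show ?thesis
    by (simp add: offspring_law_def pmf.rep_eq)
qed

section \<open>The branching property\<close>

lemma indep_coordinates: "indep_vars offspring_law (\<lambda>x X. X x) sites"
proof (cases "sites = {}")
  case False
  have "distr M (PiM sites offspring_law) (\<lambda>X. \<lambda>x\<in>sites. X x) = distr M M (\<lambda>X. X)"
    by (rule distr_cong) (auto simp: tree_law_eq space_PiM PiE_def extensional_restrict)
  also have "\<dots> = PiM sites (\<lambda>x. distr M (offspring_law x) (\<lambda>X. X x))"
    unfolding tree_law_eq distr_id
    by (intro PiM_cong refl distr_PiM_component[symmetric] prob_space_offspring_law)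
  finally show ?thesis
    using False
    by (subst indep_vars_iff_distr_eq_PiM')
      (auto simp: tree_law_eq intro!: measurable_component_singleton)
next
  case True
  then show ?thesis
    unfolding indep_vars_def2 by (simp add: indep_sets_def)
qed

text \<open>
  Independence of coordinates, grouped into the regions \<open>K a\<close>. Expressing that \<open>R a\<close> depends only
  on its region by invariance under restriction lets the same predicate serve on the product over
  the region and on the whole tree.
\<close>
lemma prob_disjoint_regions:
  assumes L: "finite L" "L \<noteq> {}"
    and K: "\<And>a. a \<in> L \<Longrightarrow> K a \<subseteq> sites" "disjoint_family_on K L"
    and R: "\<And>a. a \<in> L \<Longrightarrow> Measurable.pred (PiM (K a) offspring_law) (R a)"
    and local: "\<And>a X. a \<in> L \<Longrightarrow> X \<in> space M \<Longrightarrow> R a (restrict X (K a)) = R a X"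
  shows "prob {X \<in> space M. \<forall>a\<in>L. R a X} = (\<Prod>a\<in>L. prob {X \<in> space M. R a X})"
proof -
  have ind: "indep_vars (\<lambda>_. count_space UNIV) (\<lambda>a X. R a (restrict X (K a))) L"
    by (rule indep_vars_compose2[OF indep_vars_restrict[OF indep_coordinates K] R])
  have "prob (\<Inter>a\<in>L. (\<lambda>X. R a (restrict X (K a))) -` {True} \<inter> space M)
      = (\<Prod>a\<in>L. prob ((\<lambda>X. R a (restrict X (K a))) -` {True} \<inter> space M))"
    by (rule indep_varsD_finite[OF ind L(2,1)]) simp
  moreover have eq: "(\<lambda>X. R a (restrict X (K a))) -` {True} \<inter> space M = {X \<in> space M. R a X}"
    if "a \<in> L" for a
    using local[OF that] by auto
  moreover have "(\<Inter>a\<in>L. (\<lambda>X. R a (restrict X (K a))) -` {True} \<inter> space M)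
      = {X \<in> space M. \<forall>a\<in>L. R a X}"
    using L(2) eq by auto
  ultimately show ?thesis
    by (simp cong: prod.cong)
qed

lemma subtree_restrict:
  assumes j: "j \<in> {1..k}" and K: "below (j, m) \<subseteq> K" "K \<subseteq> sites" and X: "X \<in> space M"
  shows "subtree (j, m) (restrict X K) = subtree (j, m) X"
proof -
  have "restrict X K \<in> extensional sites" "X \<in> extensional sites"
    using K(2) X by (auto simp: tree_law_eq space_PiM PiE_def extensional_def)
  moreover have "((j, m) # fst x, snd x) \<in> K" if "x \<in> sites" for x
    using that K(1) by (auto simp: below_def)
  ultimately show ?thesis
    by (simp add: subtree_eq_reindex[OF j] cong: restrict_cong)
qed

text \<open>
  Call a child of colour \<open>j\<close> marked if its subtree satisfies \<open>Q\<close>. Given \<open>n\<close> children of colour \<open>j\<close>,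
  the first \<open>n\<close> potential subtrees are independent copies of the tree, so none is marked with
  probability \<open>(1 - q) ^ n\<close>; averaging over the Poisson number \<open>n\<close> gives its generating function at
  \<open>1 - q\<close>. Working with all potential children, present or not, is what makes the number and the
  subtrees independent.
\<close>
lemma prob_no_marked_child_of_colour:
  assumes j: "j \<in> {1..k}" and Q [measurable]: "Measurable.pred M Q"
  shows "prob {X \<in> space M. \<forall>m<X ([], j). \<not> Q (subtree (j, m) X)}
    = exp (- lam j * prob {X \<in> space M. Q X})"
proof -
  define q where "q = prob {X \<in> space M. Q X}"
  define E where
    "E n = {X \<in> space M. X ([], j) = n \<and> (\<forall>m<n. \<not> Q (subtree (j, m) X))}" for n
  note sub [measurable] = subtree_measurable_M[OF j]
  have rootM [measurable]: "(\<lambda>X. X ([], j)) \<in> measurable M (count_space UNIV)"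
    unfolding tree_law_eq using j by (intro measurable_root_offspring) (simp add: Nil_in_sites)
  have prob_E: "prob (E n) = pmf (poisson_pmf (lam j)) n * (1 - q) ^ n" for n
  proof -
    \<comment> \<open>Region \<open>0\<close> is the offspring number at the root, region \<open>m + 1\<close> the subtree at the \<open>m\<close>-th child.\<close>
    define K where "K = case_nat {([], j)} (\<lambda>m. below (j, m))"
    define R where "R = case_nat (\<lambda>X. X ([], j) = n) (\<lambda>m X. \<not> Q (subtree (j, m) X))"
    have Ksub: "K a \<subseteq> sites" for a
      using j below_subset_sites[OF j] by (auto simp: K_def Nil_in_sites split: nat.split)
    have prob_R_Suc: "prob {X \<in> space M. R (Suc m) X} = 1 - q" for m
    proof -
      have "prob {X \<in> space M. \<not> Q (subtree (j, m) X)} = 1 - prob {X \<in> space M. Q (subtree (j, m) X)}"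
        by (rule prob_neg) measurable
      then show ?thesis
        by (simp add: R_def q_def prob_subtree[OF j Q])
    qed
    have "prob {X \<in> space M. \<forall>a\<in>{..<Suc n}. R a X}
        = (\<Prod>a\<in>{..<Suc n}. prob {X \<in> space M. R a X})"
    proof (rule prob_disjoint_regions[where K = K])
      show "disjoint_family_on K {..<Suc n}"
        by (auto simp: disjoint_family_on_def K_def below_def split: nat.splits)
      show "Measurable.pred (PiM (K a) offspring_law) (R a)" for a
      proof (cases a)
        case 0
        have "([], j) \<in> K a"
          using 0 by (simp add: K_def)
        then show ?thesis
          unfolding R_def 0 nat.case
          by (rule measurable_compose[OF measurable_root_offspring]) simp
      next
        case (Suc m)
        have "subtree (j, m) \<in> measurable (PiM (K a) offspring_law) M"
          using Ksub[of a] Suc by (intro subtree_measurable j) (auto simp: K_def)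
        then show ?thesis
          unfolding R_def Suc nat.case
          by (intro pred_intros_logic measurable_compose[OF _ Q])
      qed
      show "R a (restrict X (K a)) = R a X" if "X \<in> space M" for a X
      proof (cases a)
        case (Suc m)
        then show ?thesis
          using subtree_restrict[OF j _ Ksub[of a] that, of m] by (simp add: R_def K_def)
      qed (simp add: R_def K_def)
    qed (use Ksub in auto)
    also have "{X \<in> space M. \<forall>a\<in>{..<Suc n}. R a X} = E n"
      unfolding E_def R_def by (auto simp: less_Suc_eq_0_disj split: nat.splits)
    also have "(\<Prod>a\<in>{..<Suc n}. prob {X \<in> space M. R a X})
        = pmf (poisson_pmf (lam j)) n * (1 - q) ^ n"
      unfolding prod.lessThan_Suc_shift by (simp add: prob_R_Suc) (simp add: R_def prob_root_offspring[OF j])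
    finally show ?thesis .
  qed
  have "(\<lambda>n. prob (E n)) sums prob (\<Union>n. E n)"
    unfolding E_def by (intro finite_measure_UNION) (auto simp: disjoint_family_on_def)
  moreover have "(\<lambda>n. prob (E n)) sums exp (lam j * ((1 - q) - 1))"
    unfolding prob_E by (rule poisson_generating_function[OF lam_pos[OF j]])
  ultimately have "prob (\<Union>n. E n) = exp (lam j * ((1 - q) - 1))"
    by (rule sums_unique2)
  moreover have "(\<Union>n. E n) = {X \<in> space M. \<forall>m<X ([], j). \<not> Q (subtree (j, m) X)}"
    unfolding E_def by auto
  ultimately show ?thesis
    by (simp add: q_def)
qed

text \<open>
  Different colours involve disjoint sets of sites, so the probabilities that no child
  is marked multiply over the colours. The marking may depend on the colour of the edge: this is
  what lets the set of avoidable colours shrink along the path.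
\<close>
lemma prob_some_marked_child:
  assumes "k \<ge> 1" and Q: "\<And>j. j \<in> {1..k} \<Longrightarrow> Measurable.pred M (Q j)"
  shows "prob {X \<in> space M. \<exists>j\<in>{1..k}. \<exists>m<X ([], j). Q j (subtree (j, m) X)}
    = 1 - exp (- (\<Sum>j\<in>{1..k}. lam j * prob {X \<in> space M. Q j X}))"
proof -
  define K where "K j = insert ([], j) (\<Union>m. below (j, m))" for j
  define R where "R j X \<longleftrightarrow> (\<forall>m<X ([], j). \<not> Q j (subtree (j, m) X))" for j X
  have Ksub: "K j \<subseteq> sites" if "j \<in> {1..k}" for j
    using that below_subset_sites[OF that] by (auto simp: K_def Nil_in_sites)
  have Rmeas: "Measurable.pred (PiM A offspring_law) (R j)"
    if "K j \<subseteq> A" "A \<subseteq> sites" "j \<in> {1..k}" for j A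
  proof -
    have [measurable]: "subtree (j, m) \<in> measurable (PiM A offspring_law) M" for m
      using that by (intro subtree_measurable) (auto simp: K_def)
    have [measurable]: "(\<lambda>X. X ([], j)) \<in> measurable (PiM A offspring_law) (count_space UNIV)"
      using that by (intro measurable_root_offspring) (auto simp: K_def)
    note [measurable] = Q[OF that(3)]
    show ?thesis
      unfolding R_def by measurable
  qed
  have RM [measurable]: "Measurable.pred M (R j)" if "j \<in> {1..k}" for j
    using Rmeas[OF Ksub[OF that] subset_refl that] by (simp add: tree_law_eq)
  have "prob {X \<in> space M. \<forall>j\<in>{1..k}. R j X} = (\<Prod>j\<in>{1..k}. prob {X \<in> space M. R j X})"
  proof (rule prob_disjoint_regions[where K = K])
    show "disjoint_family_on K {1..k}"
      by (auto simp: disjoint_family_on_def K_def below_def)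
    show "R j (restrict X (K j)) = R j X" if "j \<in> {1..k}" "X \<in> space M" for j X
    proof -
      have "subtree (j, m) (restrict X (K j)) = subtree (j, m) X" for m
        using that Ksub[OF that(1)] by (intro subtree_restrict) (auto simp: K_def)
      then show ?thesis
        by (simp add: R_def K_def)
    qed
  qed (use assms(1) Ksub Rmeas in auto)
  also have "\<dots> = (\<Prod>j\<in>{1..k}. exp (- lam j * prob {X \<in> space M. Q j X}))"
    unfolding R_def by (intro prod.cong refl prob_no_marked_child_of_colour Q)
  also have "\<dots> = exp (- (\<Sum>j\<in>{1..k}. lam j * prob {X \<in> space M. Q j X}))"
    by (simp add: exp_sum sum_negf[symmetric])
  finally have "prob {X \<in> space M. \<forall>j\<in>{1..k}. R j X}
      = exp (- (\<Sum>j\<in>{1..k}. lam j * prob {X \<in> space M. Q j X}))" .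
  moreover have "prob {X \<in> space M. \<not> (\<forall>j\<in>{1..k}. R j X)} = 1 - prob {X \<in> space M. \<forall>j\<in>{1..k}. R j X}"
    by (rule prob_neg) measurable
  ultimately show ?thesis
    by (simp add: R_def)
qed

section \<open>The survival probabilities\<close>

lemma reaches_measurable [measurable]: "Measurable.pred M (reaches k i n)"
proof (induction n)
  case (Suc n)
  note [measurable] = Suc.IH
  have "Measurable.pred M (\<lambda>X. \<exists>m<X ([], j). reaches k i n (subtree (j, m) X))"
    if j: "j \<in> {1..k}" for j
  proof -
    note [measurable] = subtree_measurable_M[OF j]
    have [measurable]: "(\<lambda>X. X ([], j)) \<in> measurable M (count_space UNIV)"
      unfolding tree_law_eq using j
      by (intro measurable_root_offspring) (simp add: Nil_in_sites)
    show ?thesis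
      by measurable
  qed
  then show ?case
    by (auto intro!: pred_intros_finite)
qed simp

lemma root_to_infinity_avoiding_measurable [measurable]:
  "Measurable.pred M (\<lambda>X. root_to_infinity_avoiding k X i)"
  unfolding root_to_infinity_avoiding_iff_reaches by measurable

lemma p_inf_eq: "p_inf k lam I = prob {X \<in> space M. \<exists>i\<in>I. root_to_infinity_avoiding k X i}"
  unfolding p_inf_def by (rule arg_cong[where f = prob]) auto

text \<open>
  A child reached by an edge of colour \<open>j\<close> is marked if from it some colour of \<open>I - {j}\<close> can be
  avoided forever: \<open>j\<close> itself has just been used up.
\<close>
lemma p_inf_recursion:
  assumes "k \<ge> 1" "finite I"
  shows "p_inf k lam I = 1 - exp (- (\<Sum>j\<in>{1..k}. lam j * p_inf k lam (I - {j})))"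
proof -
  let ?Q = "\<lambda>j X. \<exists>i\<in>I - {j}. root_to_infinity_avoiding k X i"
  have step: "(\<exists>i\<in>I. root_to_infinity_avoiding k X i) \<longleftrightarrow>
      (\<exists>j\<in>{1..k}. \<exists>m<X ([], j). ?Q j (subtree (j, m) X))" for X
    by (subst root_to_infinity_avoiding_step) blast
  have "Measurable.pred M (?Q j)" for j
    using assms(2) by (intro pred_intros_finite root_to_infinity_avoiding_measurable) auto
  then show ?thesis
    unfolding p_inf_eq step[abs_def] by (intro prob_some_marked_child[OF assms(1), of ?Q])
qed

lemma p_inf_mono:
  assumes "I \<subseteq> J" "finite J"
  shows "p_inf k lam I \<le> p_inf k lam J"
proof -
  have "{X \<in> space M. \<exists>i\<in>J. root_to_infinity_avoiding k X i} \<in> events"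
    using assms(2) by (intro predE pred_intros_finite root_to_infinity_avoiding_measurable)
  then show ?thesis
    unfolding p_inf_eq using assms(1) by (intro finite_measure_mono) auto
qed

text \<open>
  The depth-\<open>n\<close> survival probabilities satisfy \<open>q (n + 1) = 1 - exp (- s * q n)\<close> with \<open>q 0 = 1\<close>.
  Since \<open>exp x \<ge> 1 + x\<close>, the bound \<open>1 - 1 / s\<close> passes from \<open>q n\<close> to \<open>q (n + 1)\<close>, and it is positive
  because \<open>s > 1\<close>; it then survives in the limit.
\<close>
lemma p_inf_singleton_pos:
  assumes i: "i \<in> {1..k}" and super: "(\<Sum>j\<in>{1..k} - {i}. lam j) > 1"
  shows "p_inf k lam {i} > 0"
proof -
  define s where "s = (\<Sum>j\<in>{1..k} - {i}. lam j)"
  define q where "q n = prob {X \<in> space M. reaches k i n X}" for n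
  have s: "s > 1"
    using super by (simp add: s_def)
  have q_Suc: "q (Suc n) = 1 - exp (- (s * q n))" for n
  proof -
    have "q (Suc n) = prob {X \<in> space M. \<exists>j\<in>{1..k}. \<exists>m<X ([], j).
        j \<noteq> i \<and> reaches k i n (subtree (j, m) X)}"
      unfolding q_def reaches.simps by (rule arg_cong[where f = prob]) auto
    also have "\<dots> = 1 - exp (- (\<Sum>j\<in>{1..k}. lam j * prob {X \<in> space M. j \<noteq> i \<and> reaches k i n X}))"
      using i by (subst prob_some_marked_child) auto
    also have "(\<Sum>j\<in>{1..k}. lam j * prob {X \<in> space M. j \<noteq> i \<and> reaches k i n X})
        = (\<Sum>j\<in>{1..k} - {i}. lam j * q n)"
      by (rule sum.mono_neutral_cong_right) (auto simp: q_def)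
    also have "\<dots> = s * q n"
      by (simp add: s_def sum_distrib_right)
    finally show ?thesis .
  qed
  have q_ge: "q n \<ge> 1 - 1 / s" for n
  proof (induction n)
    case 0
    show ?case using s by (simp add: q_def prob_space)
  next
    case (Suc n)
    have "s * q n \<ge> s - 1"
      using mult_left_mono[OF Suc.IH, of s] s by (simp add: right_diff_distrib)
    then have "exp (s * q n) \<ge> s"
      using exp_ge_add_one_self[of "s * q n"] by linarith
    then have "exp (- (s * q n)) \<le> 1 / s"
      using s by (simp add: exp_minus divide_simps)
    then show ?case
      by (simp add: q_Suc)
  qed
  have "q \<longlonglongrightarrow> prob (\<Inter>n. {X \<in> space M. reaches k i n X})"
    unfolding q_def
    by (intro finite_Lim_measure_decseq)
      (auto simp: decseq_def intro: reaches_antimono)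
  moreover have "(\<Inter>n. {X \<in> space M. reaches k i n X})
      = {X \<in> space M. root_to_infinity_avoiding k X i}"
    by (auto simp: root_to_infinity_avoiding_iff_reaches)
  ultimately have "q \<longlonglongrightarrow> p_inf k lam {i}"
    by (simp add: p_inf_eq)
  then have "p_inf k lam {i} \<ge> 1 - 1 / s"
    using q_ge by (intro LIMSEQ_le_const) auto
  moreover have "1 - 1 / s > 0"
    using s by simp
  ultimately show ?thesis
    by linarith
qed

end

section \<open>The positive fixed point and the Lambert function\<close>

lemma mult_exp_strict_mono:
  fixes x y :: real
  assumes "- 1 \<le> x" "x < y"
  shows "x * exp x < y * exp y"
proof (rule DERIV_pos_imp_increasing_open[OF assms(2)])
  show "\<exists>d. ((\<lambda>w. w * exp w) has_real_derivative d) (at w) \<and> d > 0" if "x < w" "w < y" for w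
  proof (intro exI conjI)
    show "((\<lambda>w. w * exp w) has_real_derivative (1 + w) * exp w) (at w)"
      by (auto intro!: derivative_eq_intros simp: algebra_simps)
    show "(1 + w) * exp w > 0"
      using that assms by simp
  qed
qed (auto intro!: continuous_intros)

lemma lambert_W_mult_exp:
  assumes "w \<ge> - 1"
  shows "lambert_W (w * exp w) = w"
  unfolding lambert_W_def
proof (rule the_equality)
  show "v = w" if "v \<ge> - 1 \<and> v * exp v = w * exp w" for v
    using that assms mult_exp_strict_mono[of v w] mult_exp_strict_mono[of w v]
    by (cases v w rule: linorder_cases) auto
qed (use assms in simp)

text \<open>
  For \<open>c = 0\<close> there is also the fixed point \<open>p = 0\<close>, which for \<open>s > 1\<close> belongs to the other
  branch of the Lambert function; this is why \<open>p > 0\<close> is assumed. The proof that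
  \<open>w = s * (p - 1) \<ge> - 1\<close> uses concavity only through the tangent inequality
  \<open>exp (s * p) \<ge> 1 + s * p\<close>.
\<close>
lemma fixpoint_eq_lambert_W:
  fixes s c p :: real
  assumes "s > 0" "c \<ge> 0" "p > 0" and fixpoint: "p = 1 - exp (- c - s * p)"
  shows "p = 1 + lambert_W (- s * exp (- c - s)) / s"
proof -
  define w where "w = s * (p - 1)"
  have p: "1 - p = exp (- c - s * p)"
    using fixpoint by simp
  have "p * (s * (1 - p) - 1) \<le> 0"
  proof -
    have "1 - p \<ge> 0"
      unfolding p by simp
    then have "(1 - p) * (1 + s * p) \<le> (1 - p) * exp (s * p)"
      by (intro mult_left_mono exp_ge_add_one_self)
    also have "\<dots> = exp (- c)"
      unfolding p by (simp flip: exp_add)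
    also have "\<dots> \<le> 1"
      using assms(2) by simp
    finally show ?thesis
      by (simp add: algebra_simps)
  qed
  then have "s * (1 - p) - 1 \<le> 0"
    using assms(3) by (simp add: mult_le_0_iff)
  then have "w \<ge> - 1"
    by (simp add: w_def algebra_simps)
  moreover have "w * exp w = - s * exp (- c - s)"
  proof -
    have "w * exp w = - s * (exp (- c - s * p) * exp w)"
      by (simp add: w_def flip: p) (simp add: algebra_simps)
    also have "exp (- c - s * p) * exp w = exp (- c - s)"
      by (simp add: w_def algebra_simps flip: exp_add)
    finally show ?thesis .
  qed
  ultimately have "lambert_W (- s * exp (- c - s)) = w"
    using lambert_W_mult_exp by metis
  then show ?thesis
    using assms(1) by (simp add: w_def)
qed

theorem corollary6p1p8:
  fixes k :: nat and lam :: "nat \<Rightarrow> real"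
  assumes "k \<ge> 1"
    and "\<forall>i\<in>{1..k}. lam i > 0"
    and "fully_supercritical k lam"
  shows "(\<forall>I. I \<noteq> {} \<and> I \<subset> {1..k} \<longrightarrow>
            p_inf k lam I =
              1 + lambert_W (- (\<Sum>i\<in>{1..k} - I. lam i) *
                    exp (- (\<Sum>i\<in>I. lam i * p_inf k lam (I - {i})) - (\<Sum>i\<in>{1..k} - I. lam i)))
                  / (\<Sum>i\<in>{1..k} - I. lam i))
       \<and> p_inf k lam {1..k} =
            1 - exp (- (\<Sum>i\<in>{1..k}. lam i * p_inf k lam ({1..k} - {i})))"
proof (intro conjI allI impI)
  interpret poisson_tree k lam
    using assms(2) by unfold_locales auto
  show "p_inf k lam {1..k} = 1 - exp (- (\<Sum>i\<in>{1..k}. lam i * p_inf k lam ({1..k} - {i})))"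
    by (rule p_inf_recursion[OF assms(1)]) simp
  fix I :: "nat set"
  assume I: "I \<noteq> {} \<and> I \<subset> {1..k}"
  then have fin: "finite I"
    using finite_subset by blast
  define s where "s = (\<Sum>i\<in>{1..k} - I. lam i)"
  define c where "c = (\<Sum>i\<in>I. lam i * p_inf k lam (I - {i}))"
  have "s > 0"
    unfolding s_def using I assms(2) by (intro sum_pos) auto
  moreover have "c \<ge> 0"
    unfolding c_def using I assms(2) by (intro sum_nonneg mult_nonneg_nonneg) (auto simp: p_inf_def less_imp_le)
  moreover have "p_inf k lam I > 0"
  proof -
    obtain i where i: "i \<in> I" "i \<in> {1..k}"
      using I by blast
    then have "p_inf k lam {i} > 0"
      using assms(3) by (intro p_inf_singleton_pos) (auto simp: fully_supercritical_def)
    also have "\<dots> \<le> p_inf k lam I"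
      using i fin by (intro p_inf_mono) auto
    finally show ?thesis .
  qed
  moreover have "p_inf k lam I = 1 - exp (- c - s * p_inf k lam I)"
  proof -
    have "(\<Sum>j\<in>{1..k}. lam j * p_inf k lam (I - {j}))
        = (\<Sum>j\<in>{1..k} - I. lam j * p_inf k lam (I - {j})) + c"
      unfolding c_def using I by (intro sum.subset_diff) auto
    also have "(\<Sum>j\<in>{1..k} - I. lam j * p_inf k lam (I - {j})) = s * p_inf k lam I"
      unfolding s_def sum_distrib_right by (rule sum.cong) auto
    finally have "- (\<Sum>j\<in>{1..k}. lam j * p_inf k lam (I - {j})) = - c - s * p_inf k lam I"
      by simp
    then show ?thesis
      using p_inf_recursion[OF assms(1) fin] by (simp only:)
  qed
  ultimately show "p_inf k lam I = 1 + lambert_W (- (\<Sum>i\<in>{1..k} - I. lam i) *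
      exp (- (\<Sum>i\<in>I. lam i * p_inf k lam (I - {i})) - (\<Sum>i\<in>{1..k} - I. lam i)))
      / (\<Sum>i\<in>{1..k} - I. lam i)"
    unfolding s_def c_def by (rule fixpoint_eq_lambert_W)
qed

end
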